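(* Let $X$ be a real locally convex Hausdorff topological vector space, $\mathscr P_0(X^* )$ the set of nonempty weak*-closed convex subsets of $X^*$, $T$ a nonempty index set, $\emptyset\ne\mathcal U_t\subset\mathscr P_0(X^* )\times\mathbb R$ for each $t\in T$, and $\mathfrak V:=\bigcup_{t\in T}\mathcal U_t$. Assume that the system $\sigma_{\mathcal A}(x)\le b$ for all $(\mathcal A,b)\in\mathfrak V$ has a solution $x\in X$. For $c\in X^*$ consider $$({\rm RSAP}_c)\quad\inf\{\langle c,x\rangle:\ x\in X,\ \sigma_{\mathcal A_t}(x)\le b_t\ \ \forall(\mathcal A_t,b_t)\in\mathcal U_t,\ \forall t\in T\},$$ $$({\rm RSAD}^1_c)\quad\sup\{-\lambda v^2:\ V\in\mathfrak V,\ v=(v^1,v^2)\in V,\ \lambda\ge0,\ c=-\lambda v^1\}.$$ Then the following statements are equivalent: $({\rm g}_1)$ $\mathcal R_1:=\operatorname{cone}\Big(\bigcup_{V\in\mathfrak V}V\Big)+\mathbb R_+(0_{X^*},1)$ is a closed and convex subset of $X^*\times\mathbb R$; $({\rm h}_1)$ stable robust strong duality holds for the pair $({\rm RSAP}_c)-({\rm RSAD}^1_c)$, i.e. $\inf({\rm RSAP}_c)=\max({\rm RSAD}^1_c)$ for all $c\in X^*$.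
   Context: $X^*$ is the topological dual of $X$ with the weak* topology; $X^*\times\mathbb R$ has the product topology. $\sigma_{\mathcal A}(x)=\sup_{x^*\in\mathcal A}\langle x^*,x\rangle$. A pair $V=(V^1,V^2)\in\mathscr P_0(X^* )\times\mathbb R$ is identified with the subset $V^1\times\{V^2\}$ of $X^*\times\mathbb R$, so $v\in V$ means $v^1\in V^1$ and $v^2=V^2$. $\operatorname{cone}B=\{\lambda b:\lambda\ge0,b\in B\}$; $\sup\emptyset=-\infty$. "$\inf=\max$" means that the two optimal values are equal and that, when this common value is finite, the supremum in the dual problem is attained. *)

theory Defs
  imports "HOL-Analysis.Analysis"
begin

section \<open>Locally convex Hausdorff spaces\<close>

text \<open>
  The constant \<^const>\<open>convex\<close> is not available within a class specification; local convexity is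
  therefore written with the definition of \<^const>\<open>convex\<close> unfolded.
\<close>

class locally_convex_space = real_vector + t2_space + topological_ab_group_add +
  assumes tendsto_scaleR_Pair:
    "filterlim (\<lambda>p. fst p *\<^sub>R snd p) (nhds (r *\<^sub>R x)) (nhds r \<times>\<^sub>F nhds x)"
  and locally_convex_unfolded:
    "open U \<Longrightarrow> 0 \<in> U \<Longrightarrow>
      \<exists>C. open C \<and> (\<forall>x\<in>C. \<forall>y\<in>C. \<forall>u\<ge>0. \<forall>v\<ge>0. u + v = 1 \<longrightarrow> u *\<^sub>R x + v *\<^sub>R y \<in> C)
        \<and> 0 \<in> C \<and> C \<subseteq> U"

lemma locally_convex_at_0:
  fixes U :: "'a::locally_convex_space set"
  assumes "open U" "0 \<in> U"
  shows "\<exists>C. open C \<and> convex C \<and> 0 \<in> C \<and> C \<subseteq> U"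
  using locally_convex_unfolded[OF assms] unfolding convex_def .

section \<open>The topological dual with the weak* topology\<close>

typedef (overloaded) 'a dual =
  "{f :: 'a::locally_convex_space \<Rightarrow> real. linear f \<and> continuous_on UNIV f}"
  morphisms dual_apply Abs_dual
  by (rule exI[of _ "\<lambda>_. 0"]) (simp add: linear_iff)

setup_lifting type_definition_dual

instantiation dual :: (locally_convex_space) real_vector
begin

lift_definition zero_dual :: "'a dual" is "\<lambda>_. 0"
  by (simp add: linear_iff)

lift_definition plus_dual :: "'a dual \<Rightarrow> 'a dual \<Rightarrow> 'a dual" is "\<lambda>f g x. f x + g x"
  by (auto intro!: continuous_intros linear_compose_add)

lift_definition minus_dual :: "'a dual \<Rightarrow> 'a dual \<Rightarrow> 'a dual" is "\<lambda>f g x. f x - g x"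
  by (auto intro!: continuous_intros linear_compose_sub)

lift_definition uminus_dual :: "'a dual \<Rightarrow> 'a dual" is "\<lambda>f x. - f x"
  by (auto intro!: continuous_intros linear_compose_neg)

lift_definition scaleR_dual :: "real \<Rightarrow> 'a dual \<Rightarrow> 'a dual" is "\<lambda>r f x. r * f x"
  by (auto intro!: continuous_intros simp: linear_iff algebra_simps)

instance
  by standard (transfer; simp add: fun_eq_iff algebra_simps)+

end

text \<open>
  The topology of type \<open>'a \<Rightarrow> real\<close> is the product topology, that is, the topology of pointwise
  convergence. The topology it induces on the dual is therefore the coarsest one for which all
  evaluations are continuous. Products such as \<open>'a dual \<times> real\<close> carry the product topology.
\<close>

instantiation dual :: (locally_convex_space) topological_space
begin

definition open_dual :: "'a dual set \<Rightarrow> bool"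
  where "open_dual W \<longleftrightarrow> (\<exists>S. open S \<and> W = dual_apply -` S)"

instance
proof
  show "open (UNIV :: 'a dual set)"
    unfolding open_dual_def by (rule exI[of _ UNIV]) simp
next
  fix V W :: "'a dual set"
  assume "open V" "open W"
  then obtain S R where "open S" "open R" "V = dual_apply -` S" "W = dual_apply -` R"
    unfolding open_dual_def by blast
  then show "open (V \<inter> W)"
    unfolding open_dual_def by (intro exI[of _ "S \<inter> R"]) auto
next
  fix K :: "'a dual set set"
  assume "\<forall>W\<in>K. open W"
  then obtain S where "\<And>W. W \<in> K \<Longrightarrow> open (S W) \<and> W = dual_apply -` S W"
    unfolding open_dual_def by metis
  then show "open (\<Union>K)"
    unfolding open_dual_def by (intro exI[of _ "\<Union>W\<in>K. S W"]) auto
qed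

end

section \<open>The robust linear problem and its dual\<close>

definition P0 :: "'a::locally_convex_space dual set set"
  where "P0 = {\<A>. \<A> \<noteq> {} \<and> closed \<A> \<and> convex \<A>}"

definition support_fun :: "'a::locally_convex_space dual set \<Rightarrow> 'a \<Rightarrow> ereal"
  where "support_fun \<A> x = (SUP f\<in>\<A>. ereal (dual_apply f x))"

text \<open>The subset \<open>V\<^sup>1 \<times> {V\<^sup>2}\<close> identified with a pair \<open>V = (V\<^sup>1, V\<^sup>2)\<close>.\<close>

definition pair_set :: "'b set \<times> real \<Rightarrow> ('b \<times> real) set"
  where "pair_set V = fst V \<times> {snd V}"

definition cone_of :: "'b::real_vector set \<Rightarrow> 'b set"
  where "cone_of B = {l *\<^sub>R b | l b. 0 \<le> l \<and> b \<in> B}"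

definition all_pairs ::
  "'t set \<Rightarrow> ('t \<Rightarrow> ('a::locally_convex_space dual set \<times> real) set) \<Rightarrow> ('a dual set \<times> real) set"
  where "all_pairs T \<U> = (\<Union>t\<in>T. \<U> t)"

definition RSAP_feasible ::
  "'t set \<Rightarrow> ('t \<Rightarrow> ('a::locally_convex_space dual set \<times> real) set) \<Rightarrow> 'a set"
  where "RSAP_feasible T \<U> =
    {x. \<forall>t\<in>T. \<forall>(\<A>, b)\<in>\<U> t. support_fun \<A> x \<le> ereal b}"

definition inf_RSAP ::
  "'t set \<Rightarrow> ('t \<Rightarrow> ('a::locally_convex_space dual set \<times> real) set) \<Rightarrow> 'a dual \<Rightarrow> ereal"
  where "inf_RSAP T \<U> c = (INF x\<in>RSAP_feasible T \<U>. ereal (dual_apply c x))"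

definition RSAD1_feasible ::
  "'t set \<Rightarrow> ('t \<Rightarrow> ('a::locally_convex_space dual set \<times> real) set) \<Rightarrow> 'a dual
    \<Rightarrow> (('a dual set \<times> real) \<times> ('a dual \<times> real) \<times> real) set"
  where "RSAD1_feasible T \<U> c =
    {(V, v, l). V \<in> all_pairs T \<U> \<and> v \<in> pair_set V \<and> 0 \<le> l \<and> c = - (l *\<^sub>R fst v)}"

definition RSAD1_objective ::
  "('a::locally_convex_space dual set \<times> real) \<times> ('a dual \<times> real) \<times> real \<Rightarrow> ereal"
  where "RSAD1_objective = (\<lambda>(V, v, l). ereal (- (l * snd v)))"

definition sup_RSAD1 ::
  "'t set \<Rightarrow> ('t \<Rightarrow> ('a::locally_convex_space dual set \<times> real) set) \<Rightarrow> 'a dual \<Rightarrow> ereal"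
  where "sup_RSAD1 T \<U> c = (SUP z\<in>RSAD1_feasible T \<U> c. RSAD1_objective z)"

definition stable_robust_strong_duality1 ::
  "'t set \<Rightarrow> ('t \<Rightarrow> ('a::locally_convex_space dual set \<times> real) set) \<Rightarrow> bool"
  where "stable_robust_strong_duality1 T \<U> \<longleftrightarrow>
    (\<forall>c. inf_RSAP T \<U> c = sup_RSAD1 T \<U> c \<and>
      (\<bar>sup_RSAD1 T \<U> c\<bar> \<noteq> \<infinity> \<longrightarrow>
        (\<exists>z\<in>RSAD1_feasible T \<U> c. RSAD1_objective z = sup_RSAD1 T \<U> c)))"

text \<open>The addition below is the Minkowski sum of sets.\<close>

definition R1_cone ::
  "'t set \<Rightarrow> ('t \<Rightarrow> ('a::locally_convex_space dual set \<times> real) set) \<Rightarrow> ('a dual \<times> real) set"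
  where "R1_cone T \<U> =
    cone_of (\<Union>V\<in>all_pairs T \<U>. pair_set V) + {r *\<^sub>R (0, 1) | r. 0 \<le> r}"

end

theory Submission
  imports Defs
begin

text \<open>
  Let \<open>E\<close> be the set of all \<open>(f, \<beta>)\<close> such that \<open>f \<le> \<beta>\<close> on the feasible set. It is closed and convex,
  and it contains \<open>\<R>\<^sub>1\<close> (weak duality). The primal value at \<open>c\<close> is at least \<open>-\<beta>\<close> iff
  \<open>(-c, \<beta>) \<in> E\<close>, while some dual feasible point has value at least \<open>-\<beta>\<close> iff
  \<open>(-c, \<beta>) \<in> \<R>\<^sub>1\<close>; hence stable strong duality says exactly that \<open>\<R>\<^sub>1 = E\<close>. Conversely, if
  \<open>\<R>\<^sub>1\<close> is closed and convex, a point of \<open>E\<close> outside it could be separated from it by some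
  \<open>(x, s) \<in> X \<times> \<real>\<close>. For \<open>s \<noteq> 0\<close>, rescaling \<open>x\<close> gives a feasible point violating the inequality
  \<open>f \<le> \<beta>\<close>; for \<open>s = 0\<close>, the vector \<open>x\<close> is a recession direction of the feasible set along which \<open>f\<close>
  is unbounded.
\<close>

section \<open>Separation in the weak* topology\<close>

text \<open>
  A weak* neighbourhood involves only finitely many functionals. The coefficients \<open>a\<close> are the point of
  minimal norm in the closure of the image of \<open>C\<close> in the Euclidean space \<open>\<real>\<^sup>S\<close>. As the cardinality of
  \<open>S\<close> is arbitrary, this space is not available as a type.
\<close>

lemma separate_zero_by_finitely_many_functionals:
  fixes \<phi> :: "'i \<Rightarrow> 'v::real_vector \<Rightarrow> real"
  assumes "convex C" and lin: "\<And>i. i \<in> S \<Longrightarrow> linear (\<phi> i)"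
    and away: "\<And>c. c \<in> C \<Longrightarrow> d \<le> (\<Sum>i\<in>S. (\<phi> i c)\<^sup>2)"
  obtains a where "\<And>c. c \<in> C \<Longrightarrow> d \<le> (\<Sum>i\<in>S. a i * \<phi> i c)"
proof (cases "C = {} \<or> infinite S")
  case True
  \<comment> \<open>For infinite \<open>S\<close> both sums take the default value 0, so
    \<open>away\<close> gives d \<le> 0 and zero coefficients suffice.\<close>
  then show ?thesis
    using that[of "\<lambda>_. 0"] away by force
next
  case False
  then have ne: "C \<noteq> {}" and fin: "finite S" by auto
  define q where "q c = (\<Sum>i\<in>S. (\<phi> i c)\<^sup>2)" for c
  define m where "m = Inf (q ` C)"
  have bdd: "bdd_below (q ` C)"
    using away unfolding q_def by (auto intro!: bdd_belowI2)
  have m_le: "m \<le> q c" if "c \<in> C" for c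
    unfolding m_def using that bdd by (simp add: cInf_lower)
  have d_le: "d \<le> m"
    unfolding m_def using ne away by (intro cINF_greatest) (auto simp: q_def)
  have "\<exists>c\<in>C. q c < m + 1 / real (Suc n)" for n
    using cInf_lessD[of "q ` C" "m + 1 / real (Suc n)"] ne unfolding m_def by auto
  then obtain c where c: "\<And>n. c n \<in> C" and c_min: "\<And>n. q (c n) < m + 1 / real (Suc n)"
    by metis
  \<comment> \<open>Parallelogram law: the midpoint of two members lies in \<open>C\<close>, so its
    \<open>q\<close>-value is at least \<open>m\<close>, while the two members are nearly minimal.
    Hence every coordinate of the minimizing sequence is Cauchy.\<close>
  have parallelogram: "(\<phi> i (c n) - \<phi> i (c k))\<^sup>2 \<le> 2 / real (Suc n) + 2 / real (Suc k)"
    if "i \<in> S" for i n k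
  proof -
    let ?z = "(1/2) *\<^sub>R c n + (1/2) *\<^sub>R c k"
    have z: "?z \<in> C"
      using \<open>convex C\<close> c by (intro convexD) auto
    have "(\<phi> i (c n) - \<phi> i (c k))\<^sup>2 \<le> (\<Sum>j\<in>S. (\<phi> j (c n) - \<phi> j (c k))\<^sup>2)"
      using fin that by (intro member_le_sum) auto
    also have "\<dots> = (\<Sum>j\<in>S. 2 * (\<phi> j (c n))\<^sup>2 + 2 * (\<phi> j (c k))\<^sup>2 - 4 * (\<phi> j ?z)\<^sup>2)"
      by (intro sum.cong refl)
        (simp add: linear_add[OF lin] linear_scale[OF lin] power2_eq_square algebra_simps)
    also have "\<dots> = 2 * q (c n) + 2 * q (c k) - 4 * q ?z"
      by (simp add: q_def sum.distrib sum_subtractf sum_distrib_left)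
    also have "\<dots> \<le> 2 / real (Suc n) + 2 / real (Suc k)"
      using m_le[OF z] c_min[of n] c_min[of k] by linarith
    finally show ?thesis .
  qed
  have "convergent (\<lambda>n. \<phi> i (c n))" if "i \<in> S" for i
  proof (rule Cauchy_convergent, rule metric_CauchyI)
    fix e :: real assume "0 < e"
    from \<open>0 < e\<close> have "0 < e\<^sup>2 / 4" by simp
    then obtain M where M: "1 / real (Suc M) < e\<^sup>2 / 4"
      by (rule nat_approx_posE)
    have "dist (\<phi> i (c n)) (\<phi> i (c k)) < e" if "n \<ge> M" "k \<ge> M" for n k
    proof -
      have "2 / real (Suc n) \<le> 2 / real (Suc M)" "2 / real (Suc k) \<le> 2 / real (Suc M)"
        using that by (auto intro!: divide_left_mono)
      then have "(\<phi> i (c n) - \<phi> i (c k))\<^sup>2 < e\<^sup>2"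
        using parallelogram[OF \<open>i \<in> S\<close>, of n k] M by linarith
      then have "\<bar>\<phi> i (c n) - \<phi> i (c k)\<bar>\<^sup>2 < e\<^sup>2" by simp
      then show ?thesis
        unfolding dist_real_def by (rule power2_less_imp_less) (use \<open>0 < e\<close> in simp)
    qed
    then show "\<exists>M. \<forall>n\<ge>M. \<forall>k\<ge>M. dist (\<phi> i (c n)) (\<phi> i (c k)) < e" by blast
  qed
  then obtain a where a: "\<And>i. i \<in> S \<Longrightarrow> (\<lambda>n. \<phi> i (c n)) \<longlonglongrightarrow> a i"
    unfolding convergent_def by metis
  have a_min: "(\<Sum>i\<in>S. (a i)\<^sup>2) \<le> m"
  proof (rule LIMSEQ_le)
    show "(\<lambda>n. q (c n)) \<longlonglongrightarrow> (\<Sum>i\<in>S. (a i)\<^sup>2)"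
      unfolding q_def by (intro tendsto_sum tendsto_power a)
    show "(\<lambda>n. m + 1 / real (Suc n)) \<longlonglongrightarrow> m"
      using tendsto_add[OF tendsto_const LIMSEQ_inverse_real_of_nat, of m]
      by (simp add: inverse_eq_divide)
  qed (use c_min less_imp_le in blast)
  have "m \<le> (\<Sum>i\<in>S. a i * \<phi> i y)" if y: "y \<in> C" for y
  proof -
    define B where "B = (\<Sum>i\<in>S. a i * \<phi> i y)"
    \<comment> \<open>The variational inequality at the nearest point. As \<open>a\<close> need not
      lie in the image of \<open>C\<close>, the lower bound \<open>m\<close> on the segment towards
      \<open>y\<close> is obtained from the segments starting at \<open>c n\<close>. Dividing by
      \<open>t\<close> and letting \<open>t\<close> tend to 0 leaves
      \<open>m \<le> B\<close>.\<close>
    have segment: "0 \<le> (t - 2) * m + 2 * (1 - t) * B + t * q y" if "0 < t" "t < 1" for t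
    proof -
      have "m \<le> (\<Sum>i\<in>S. ((1 - t) * a i + t * \<phi> i y)\<^sup>2)"
      proof (rule LIMSEQ_le_const)
        show "(\<lambda>n. \<Sum>i\<in>S. ((1 - t) * \<phi> i (c n) + t * \<phi> i y)\<^sup>2)
            \<longlonglongrightarrow> (\<Sum>i\<in>S. ((1 - t) * a i + t * \<phi> i y)\<^sup>2)"
          by (intro tendsto_intros a)
        have "m \<le> (\<Sum>i\<in>S. ((1 - t) * \<phi> i (c n) + t * \<phi> i y)\<^sup>2)" for n
        proof -
          have "(1 - t) *\<^sub>R c n + t *\<^sub>R y \<in> C"
            using \<open>convex C\<close> c y that by (intro convexD) auto
          from m_le[OF this] show ?thesis
            by (simp add: q_def linear_add[OF lin] linear_scale[OF lin])
        qed
        then show "\<exists>N. \<forall>n\<ge>N. m \<le> (\<Sum>i\<in>S. ((1 - t) * \<phi> i (c n) + t * \<phi> i y)\<^sup>2)" by blast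
      qed
      also have "\<dots> = (1 - t)\<^sup>2 * (\<Sum>i\<in>S. (a i)\<^sup>2) + 2 * t * (1 - t) * B + t\<^sup>2 * q y"
        unfolding q_def B_def sum_distrib_left sum.distrib[symmetric]
        by (intro sum.cong refl) (simp add: power2_eq_square algebra_simps)
      also have "\<dots> \<le> (1 - t)\<^sup>2 * m + 2 * t * (1 - t) * B + t\<^sup>2 * q y"
        using a_min by (simp add: mult_left_mono)
      finally have "0 \<le> t * ((t - 2) * m + 2 * (1 - t) * B + t * q y)"
        by (simp add: power2_eq_square algebra_simps)
      then show ?thesis
        using \<open>0 < t\<close> by (simp add: zero_le_mult_iff)
    qed
    have "0 \<le> (0 - 2) * m + 2 * (1 - 0) * B + 0 * q y"
    proof (rule tendsto_lowerbound)
      show "((\<lambda>t. (t - 2) * m + 2 * (1 - t) * B + t * q y)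
          \<longlongrightarrow> (0 - 2) * m + 2 * (1 - 0) * B + 0 * q y) (at_right 0)"
        by (intro tendsto_intros)
      show "\<forall>\<^sub>F t in at_right 0. 0 \<le> (t - 2) * m + 2 * (1 - t) * B + t * q y"
        unfolding eventually_at_right_field using segment zero_less_one by blast
    qed simp
    then show ?thesis by (simp add: B_def)
  qed
  with d_le show ?thesis using that by (meson order_trans)
qed

lemma linear_dual_apply: "linear (dual_apply f)"
  using dual_apply[of f] by simp

lemma linear_evaluation: "linear (\<lambda>f. dual_apply f x)"
  by (intro linearI) (simp_all add: plus_dual.rep_eq scaleR_dual.rep_eq)

lemma continuous_on_evaluation: "continuous_on A (\<lambda>f. dual_apply f x)"
proof -
  have "continuous_on UNIV (dual_apply :: 'a dual \<Rightarrow> _)"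
    unfolding continuous_on_open_vimage[OF open_UNIV] open_dual_def by auto
  then have "continuous_on UNIV (\<lambda>f :: 'a dual. dual_apply f x)"
    by (rule continuous_on_product_then_coordinatewise)
  then show ?thesis
    using continuous_on_subset by blast
qed

text \<open>A basic open set of the product topology restricts only finitely many evaluations, so
  one radius serves for all of them and for the real component.\<close>

lemma dual_times_real_basic_neighbourhood:
  fixes p :: "'a::locally_convex_space dual \<times> real"
  assumes "open W" "p \<in> W"
  obtains F e where "finite F" "0 < e"
    "\<And>g \<gamma>. \<lbrakk>\<And>x. x \<in> F \<Longrightarrow> \<bar>dual_apply g x - dual_apply (fst p) x\<bar> < e; \<bar>\<gamma> - snd p\<bar> < e\<rbrakk>
      \<Longrightarrow> (g, \<gamma>) \<in> W"
proof -
  obtain A B where AB: "open A" "open B" "fst p \<in> A" "snd p \<in> B" "A \<times> B \<subseteq> W"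
    using open_prod_elim[OF assms] by (metis mem_Times_iff)
  obtain G where G: "open G" "A = dual_apply -` G"
    using \<open>open A\<close> unfolding open_dual_def by blast
  have "dual_apply (fst p) \<in> G" using AB G by auto
  moreover have "\<exists>Y. f \<in> (\<Pi>\<^sub>E x\<in>UNIV. Y x) \<and> (\<forall>x. open (Y x)) \<and> finite {x. Y x \<noteq> UNIV}
      \<and> (\<Pi>\<^sub>E x\<in>UNIV. Y x) \<subseteq> G" if "f \<in> G" for f
    using product_topology_open_contains_basis[of "\<lambda>_. euclidean" UNIV G f] G(1) that
    by (simp add: open_fun_def)
  ultimately obtain Y where Y: "dual_apply (fst p) \<in> (\<Pi>\<^sub>E x\<in>UNIV. Y x)" "\<And>x. open (Y x)"
      "finite {x. Y x \<noteq> UNIV}" "(\<Pi>\<^sub>E x\<in>UNIV. Y x) \<subseteq> G"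
    by blast
  let ?F = "{x. Y x \<noteq> UNIV}"
  have "\<exists>e>0. \<forall>s. \<bar>s - dual_apply (fst p) x\<bar> < e \<longrightarrow> s \<in> Y x" for x
    using Y(1) Y(2)[of x] unfolding open_dist dist_real_def by auto
  then obtain r where r: "\<And>x. 0 < r x"
      "\<And>x s. \<bar>s - dual_apply (fst p) x\<bar> < r x \<Longrightarrow> s \<in> Y x"
    by metis
  obtain r' where r': "0 < r'" "\<And>s. \<bar>s - snd p\<bar> < r' \<Longrightarrow> s \<in> B"
    using AB(2,4) unfolding open_dist dist_real_def by blast
  \<comment> \<open>Inserting \<open>r'\<close> also keeps the set nonempty when no evaluation is
    restricted.\<close>
  define e where "e = Min (insert r' (r ` ?F))"
  have e: "0 < e" "e \<le> r'" "\<And>x. x \<in> ?F \<Longrightarrow> e \<le> r x"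
    unfolding e_def using Y(3) r(1) r'(1) by auto
  show ?thesis
  proof (rule that[of ?F e])
    fix g \<gamma>
    assume g: "\<And>x. x \<in> ?F \<Longrightarrow> \<bar>dual_apply g x - dual_apply (fst p) x\<bar> < e" and "\<bar>\<gamma> - snd p\<bar> < e"
    have "dual_apply g x \<in> Y x" for x
      using g[of x] e(3)[of x] r(2)[of "dual_apply g x" x] by fastforce
    then have "dual_apply g \<in> G" using Y(4) by (auto simp: PiE_def)
    moreover have "\<gamma> \<in> B" using r'(2) e(2) \<open>\<bar>\<gamma> - snd p\<bar> < e\<close> by auto
    ultimately show "(g, \<gamma>) \<in> W" using AB(5) G(2) by auto
  qed (use Y(3) e(1) in auto)
qed

text \<open>\<open>K\<close> misses a basic neighbourhood of \<open>p\<close>, so each of its points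
  differs from \<open>p\<close> by at least \<open>e\<close> in one of finitely many coordinates;
  this reduces to the finite-dimensional case. A linear combination of evaluations is again an
  evaluation, hence the separating functional is given by a vector \<open>x\<close> and a number
  \<open>s\<close>.\<close>

lemma separate_point_closed_convex_dual_times_real:
  fixes K :: "('a::locally_convex_space dual \<times> real) set"
  assumes "closed K" "convex K" "p \<notin> K"
  obtains x s where
    "\<And>k. k \<in> K \<Longrightarrow> dual_apply (fst k) x + s * snd k < dual_apply (fst p) x + s * snd p"
proof -
  obtain F e where F: "finite F" and e: "0 < e" and nbhd:
    "\<And>g \<gamma>. \<lbrakk>\<And>x. x \<in> F \<Longrightarrow> \<bar>dual_apply g x - dual_apply (fst p) x\<bar> < e; \<bar>\<gamma> - snd p\<bar> < e\<rbrakk>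
      \<Longrightarrow> (g, \<gamma>) \<in> - K"
  proof (rule dual_times_real_basic_neighbourhood)
    show "open (- K)" "p \<in> - K" using assms by auto
  qed blast
  \<comment> \<open>The index \<open>None\<close> stands for the real component,
    \<open>Some x\<close> for evaluation at \<open>x\<close>.\<close>
  define \<phi> :: "'a option \<Rightarrow> 'a dual \<times> real \<Rightarrow> real"
    where "\<phi> i k = (case i of None \<Rightarrow> snd k | Some x \<Rightarrow> dual_apply (fst k) x)" for i k
  let ?S = "insert None (Some ` F)"
  have lin: "linear (\<phi> i)" for i
    by (cases i)
      (auto simp: \<phi>_def linear_iff linear_add[OF linear_evaluation] linear_scale[OF linear_evaluation])
  obtain a where a: "\<And>z. z \<in> (\<lambda>k. k - p) ` K \<Longrightarrow> e\<^sup>2 \<le> (\<Sum>i\<in>?S. a i * \<phi> i z)"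
  proof (rule separate_zero_by_finitely_many_functionals)
    show "convex ((\<lambda>k. k - p) ` K)"
      using \<open>convex K\<close> by (rule convex_translation_subtract)
    fix z assume "z \<in> (\<lambda>k. k - p) ` K"
    then obtain k where k: "k \<in> K" "z = k - p" by blast
    have "\<exists>i\<in>?S. e \<le> \<bar>\<phi> i z\<bar>"
      using nbhd[of "fst k" "snd k"] k
      by (force simp: \<phi>_def minus_dual.rep_eq not_less)
    then obtain i where i: "i \<in> ?S" "e \<le> \<bar>\<phi> i z\<bar>" by blast
    then have "e\<^sup>2 \<le> (\<phi> i z)\<^sup>2"
      using e by (metis abs_le_square_iff abs_of_pos)
    also have "\<dots> \<le> (\<Sum>i\<in>?S. (\<phi> i z)\<^sup>2)"
      using F i(1) by (intro member_le_sum) auto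
    finally show "e\<^sup>2 \<le> (\<Sum>i\<in>?S. (\<phi> i z)\<^sup>2)" .
  next
    show "linear (\<phi> i)" for i by (rule lin)
  qed blast
  \<comment> \<open>The functional found is positive on \<open>K - p\<close>; the minus sign puts
    \<open>K\<close> on the smaller side.\<close>
  let ?x = "- (\<Sum>x\<in>F. a (Some x) *\<^sub>R x)"
  show ?thesis
  proof (rule that[of ?x "- a None"])
    fix k assume "k \<in> K"
    have sum_eq: "(\<Sum>i\<in>?S. a i * \<phi> i k) = a None * snd k - dual_apply (fst k) ?x" for k
      using F by (simp add: sum.reindex \<phi>_def linear_sum[OF linear_dual_apply]
          linear_scale[OF linear_dual_apply] linear_neg[OF linear_dual_apply])
    have "0 < e\<^sup>2" using e by simp
    also have "\<dots> \<le> (\<Sum>i\<in>?S. a i * \<phi> i (k - p))" using a \<open>k \<in> K\<close> by blast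
    finally show "dual_apply (fst k) ?x + - a None * snd k < dual_apply (fst p) ?x + - a None * snd p"
      unfolding sum_eq by (simp add: minus_dual.rep_eq algebra_simps)
  qed
qed

text \<open>A linear functional bounded above on a cone is nonpositive there, since a positive value
  could be rescaled to reach the bound. The multiple 0 shows that the strict bound at
  \<open>p\<close> is positive.\<close>

lemma separate_point_closed_convex_cone_dual_times_real:
  fixes K :: "('a::locally_convex_space dual \<times> real) set"
  assumes "closed K" "convex K" "p \<notin> K" "K \<noteq> {}"
    and scale: "\<And>l k. 0 \<le> l \<Longrightarrow> k \<in> K \<Longrightarrow> l *\<^sub>R k \<in> K"
  obtains x s where "\<And>k. k \<in> K \<Longrightarrow> dual_apply (fst k) x + s * snd k \<le> 0"
    "0 < dual_apply (fst p) x + s * snd p"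
proof -
  obtain x s where
    sep: "\<And>k. k \<in> K \<Longrightarrow> dual_apply (fst k) x + s * snd k < dual_apply (fst p) x + s * snd p"
    using separate_point_closed_convex_dual_times_real[OF assms(1-3)] by metis
  define P where "P = dual_apply (fst p) x + s * snd p"
  have scaled: "l * (dual_apply (fst k) x + s * snd k) < P" if "0 \<le> l" "k \<in> K" for l k
    using sep[OF scale[OF that]] by (simp add: P_def scaleR_dual.rep_eq algebra_simps)
  have "0 < P" using scaled[of 0] \<open>K \<noteq> {}\<close> by auto
  moreover have "dual_apply (fst k) x + s * snd k \<le> 0" if "k \<in> K" for k
  proof (rule ccontr)
    assume "\<not> ?thesis"
    then have "P / (dual_apply (fst k) x + s * snd k) * (dual_apply (fst k) x + s * snd k) = P"
      "0 \<le> P / (dual_apply (fst k) x + s * snd k)"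
      using \<open>0 < P\<close> by auto
    then show False using scaled[OF _ that] by (metis less_irrefl)
  qed
  ultimately show ?thesis using that unfolding P_def by blast
qed

section \<open>The cone and the consequences of the system\<close>

text \<open>The set \<open>E\<close> of the overview: the epigraph of the support function of the
  feasible set.\<close>

definition system_consequences ::
  "'t set \<Rightarrow> ('t \<Rightarrow> ('a::locally_convex_space dual set \<times> real) set) \<Rightarrow> ('a dual \<times> real) set"
  where "system_consequences T \<U> = {(f, \<beta>). \<forall>x\<in>RSAP_feasible T \<U>. dual_apply f x \<le> \<beta>}"

lemma RSAP_feasible_iff:
  "x \<in> RSAP_feasible T \<U> \<longleftrightarrow> (\<forall>V\<in>all_pairs T \<U>. \<forall>v\<in>pair_set V. dual_apply (fst v) x \<le> snd v)"
  by (fastforce simp: RSAP_feasible_def all_pairs_def pair_set_def support_fun_def SUP_le_iff)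

text \<open>The upward ray absorbs the slack in the second component. In this form membership reads
  as dual feasibility of \<open>(V, v, l)\<close> for c = -f with objective value at least
  -\<beta>.\<close>

lemma R1_cone_iff:
  "(f, \<beta>) \<in> R1_cone T \<U> \<longleftrightarrow>
    (\<exists>V\<in>all_pairs T \<U>. \<exists>v\<in>pair_set V. \<exists>l\<ge>0. f = l *\<^sub>R fst v \<and> l * snd v \<le> \<beta>)"
proof
  assume "(f, \<beta>) \<in> R1_cone T \<U>"
  then obtain a b where "(f, \<beta>) = a + b" "a \<in> cone_of (\<Union>V\<in>all_pairs T \<U>. pair_set V)"
    and "b \<in> {r *\<^sub>R (0, 1) | r. 0 \<le> r}"
    unfolding R1_cone_def by (rule set_plus_elim)
  moreover from this(2) obtain l v V
    where "V \<in> all_pairs T \<U>" "v \<in> pair_set V" "0 \<le> l" "a = l *\<^sub>R v"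
    unfolding cone_of_def by blast
  moreover from calculation have "f = l *\<^sub>R fst v" "l * snd v \<le> \<beta>"
    by (auto simp: prod_eq_iff)
  ultimately show "\<exists>V\<in>all_pairs T \<U>. \<exists>v\<in>pair_set V. \<exists>l\<ge>0. f = l *\<^sub>R fst v \<and> l * snd v \<le> \<beta>"
    by blast
next
  assume "\<exists>V\<in>all_pairs T \<U>. \<exists>v\<in>pair_set V. \<exists>l\<ge>0. f = l *\<^sub>R fst v \<and> l * snd v \<le> \<beta>"
  then obtain V v l where *: "V \<in> all_pairs T \<U>" "v \<in> pair_set V" "0 \<le> l"
    "f = l *\<^sub>R fst v" "l * snd v \<le> \<beta>" by blast
  have "(f, \<beta>) = l *\<^sub>R v + (\<beta> - l * snd v) *\<^sub>R (0, 1)"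
    using *(4) by (simp add: prod_eq_iff)
  moreover have "l *\<^sub>R v \<in> cone_of (\<Union>V\<in>all_pairs T \<U>. pair_set V)"
    using * unfolding cone_of_def by blast
  moreover have "(\<beta> - l * snd v) *\<^sub>R (0, 1) \<in> {r *\<^sub>R (0 :: 'a dual, 1 :: real) | r. 0 \<le> r}"
    using *(5) by (intro CollectI exI[of _ "\<beta> - l * snd v"]) simp
  ultimately show "(f, \<beta>) \<in> R1_cone T \<U>"
    unfolding R1_cone_def by (simp only: set_plus_intro)
qed

lemma R1_coneE:
  assumes "k \<in> R1_cone T \<U>"
  obtains V v l where "V \<in> all_pairs T \<U>" "v \<in> pair_set V" "0 \<le> l"
    "fst k = l *\<^sub>R fst v" "l * snd v \<le> snd k"
  using assms R1_cone_iff[of "fst k" "snd k" T \<U>] by (metis prod.collapse)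

lemma R1_cone_scale:
  assumes "0 \<le> r" "k \<in> R1_cone T \<U>"
  shows "r *\<^sub>R k \<in> R1_cone T \<U>"
proof -
  obtain V v l where *: "V \<in> all_pairs T \<U>" "v \<in> pair_set V" "0 \<le> l"
    "fst k = l *\<^sub>R fst v" "l * snd v \<le> snd k"
    using assms(2) by (rule R1_coneE)
  then have "r *\<^sub>R fst k = (r * l) *\<^sub>R fst v" "(r * l) * snd v \<le> r * snd k"
    using assms(1) by (auto simp: mult.assoc intro: mult_left_mono)
  then have "(r *\<^sub>R fst k, r * snd k) \<in> R1_cone T \<U>"
    unfolding R1_cone_iff using * assms(1) by (metis mult_nonneg_nonneg)
  then show ?thesis by (cases k) simp
qed

lemma pair_set_subset_R1_cone:
  assumes "V \<in> all_pairs T \<U>"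
  shows "pair_set V \<subseteq> R1_cone T \<U>"
proof
  fix v assume "v \<in> pair_set V"
  then have "(fst v, snd v) \<in> R1_cone T \<U>"
    unfolding R1_cone_iff using assms by (intro bexI exI[of _ 1]) auto
  then show "v \<in> R1_cone T \<U>" by simp
qed

text \<open>Multiply one inequality of the system by \<open>l\<close> and relax its right-hand
  side.\<close>

lemma R1_cone_subset_consequences: "R1_cone T \<U> \<subseteq> system_consequences T \<U>"
proof
  fix k assume "k \<in> R1_cone T \<U>"
  then obtain V v l where *: "V \<in> all_pairs T \<U>" "v \<in> pair_set V" "0 \<le> l"
    "fst k = l *\<^sub>R fst v" "l * snd v \<le> snd k"
    by (rule R1_coneE)
  have "dual_apply (fst k) x \<le> snd k" if "x \<in> RSAP_feasible T \<U>" for x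
    using that * unfolding RSAP_feasible_iff
    by (force simp: scaleR_dual.rep_eq intro: order_trans[OF mult_left_mono])
  then show "k \<in> system_consequences T \<U>"
    by (auto simp: system_consequences_def)
qed

text \<open>Each set on the right is a closed half-space, evaluation at \<open>x\<close> being
  linear and weak* continuous; closedness and convexity follow from this.\<close>

lemma system_consequences_eq_Inter:
  "system_consequences T \<U> = (\<Inter>x\<in>RSAP_feasible T \<U>. {k. dual_apply (fst k) x \<le> snd k})"
  by (auto simp: system_consequences_def)

lemma closed_system_consequences: "closed (system_consequences T \<U>)"
  unfolding system_consequences_eq_Inter
  by (intro closed_INT ballI closed_Collect_le subset_UNIV continuous_on_snd continuous_on_id
      continuous_on_compose2[OF continuous_on_evaluation[of UNIV] continuous_on_fst[OF continuous_on_id]])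

lemma convex_system_consequences: "convex (system_consequences T \<U>)"
  unfolding system_consequences_eq_Inter
  by (intro convex_INT)
    (auto simp: convex_def plus_dual.rep_eq scaleR_dual.rep_eq intro!: add_mono mult_left_mono)

lemma consequences_subset_R1_cone:
  assumes "closed (R1_cone T \<U>)" "convex (R1_cone T \<U>)"
    and feasible: "x0 \<in> RSAP_feasible T \<U>"
    and nonempty: "V0 \<in> all_pairs T \<U>" "v0 \<in> pair_set V0"
  shows "system_consequences T \<U> \<subseteq> R1_cone T \<U>"
proof
  fix p assume p: "p \<in> system_consequences T \<U>"
  then have p_le: "dual_apply (fst p) x \<le> snd p" if "x \<in> RSAP_feasible T \<U>" for x
    using that by (auto simp: system_consequences_def)
  show "p \<in> R1_cone T \<U>"
  proof (rule ccontr)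
    assume "p \<notin> R1_cone T \<U>"
    \<comment> \<open>The multiplier 0 yields the upward unit vector, which makes the cone nonempty
      and forces \<open>s \<le> 0\<close>.\<close>
    have unit: "(0, 1) \<in> R1_cone T \<U>"
      unfolding R1_cone_iff using nonempty by (intro bexI exI[of _ 0]) auto
    obtain x s where sep: "\<And>k. k \<in> R1_cone T \<U> \<Longrightarrow> dual_apply (fst k) x + s * snd k \<le> 0"
      and p_pos: "0 < dual_apply (fst p) x + s * snd p"
      using separate_point_closed_convex_cone_dual_times_real[OF assms(1,2) \<open>p \<notin> _\<close> _ R1_cone_scale]
        unit by (metis empty_iff)
    have sep_pair: "dual_apply (fst v) x + s * snd v \<le> 0"
      if "V \<in> all_pairs T \<U>" "v \<in> pair_set V" for V v
      using sep pair_set_subset_R1_cone that by blast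
    have "s \<le> 0" using sep[OF unit] by (simp add: zero_dual.rep_eq)
    then consider "s < 0" | "s = 0" by linarith
    then show False
    proof cases
      case 1
      \<comment> \<open>This scaling normalizes the coefficient of \<beta> to -1, so that separation
        turns into feasibility of \<open>?y\<close> and violation of the inequality given by
        \<open>p\<close>.\<close>
      let ?y = "(1 / - s) *\<^sub>R x"
      have y: "dual_apply f ?y \<le> \<beta> \<longleftrightarrow> dual_apply f x + s * \<beta> \<le> 0" for f \<beta>
        using 1 pos_divide_le_eq[of "- s" "dual_apply f x" \<beta>]
        by (auto simp: linear_scale[OF linear_dual_apply] linear_neg[OF linear_dual_apply]
            algebra_simps)
      have "?y \<in> RSAP_feasible T \<U>"
        unfolding RSAP_feasible_iff using sep_pair y by blast
      then show False using p_le y p_pos by (meson not_less)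
    next
      case 2
      \<comment> \<open>The step length raises the value of \<open>fst p\<close> by one more than
        its distance to \<open>snd p\<close> at \<open>x0\<close>.\<close>
      let ?r = "(\<bar>snd p - dual_apply (fst p) x0\<bar> + 1) / dual_apply (fst p) x"
      let ?y = "x0 + ?r *\<^sub>R x"
      have y: "dual_apply f ?y = dual_apply f x0 + ?r * dual_apply f x" for f
        by (simp only: linear_add[OF linear_dual_apply] linear_scale[OF linear_dual_apply] real_scaleR_def)
      have "0 \<le> ?r" using 2 p_pos by simp
      have "dual_apply (fst v) ?y \<le> snd v" if "V \<in> all_pairs T \<U>" "v \<in> pair_set V" for V v
      proof -
        have "?r * dual_apply (fst v) x \<le> 0"
          using sep_pair[OF that] 2 \<open>0 \<le> ?r\<close> by (simp only: mult_nonneg_nonpos mult_zero_left add_0_right)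
        moreover have "dual_apply (fst v) x0 \<le> snd v"
          using feasible that unfolding RSAP_feasible_iff by blast
        ultimately show ?thesis unfolding y by linarith
      qed
      then have "dual_apply (fst p) ?y \<le> snd p"
        using p_le unfolding RSAP_feasible_iff by blast
      moreover have "?r * dual_apply (fst p) x = \<bar>snd p - dual_apply (fst p) x0\<bar> + 1"
        using 2 p_pos by simp
      ultimately show False unfolding y by linarith
    qed
  qed
qed

section \<open>Strong duality\<close>

lemma le_inf_RSAP_iff:
  "ereal (- \<beta>) \<le> inf_RSAP T \<U> c \<longleftrightarrow> (- c, \<beta>) \<in> system_consequences T \<U>"
  by (auto simp: inf_RSAP_def le_INF_iff system_consequences_def uminus_dual.rep_eq)

lemma RSAD1_feasible_ge_iff:
  "(\<exists>z\<in>RSAD1_feasible T \<U> c. ereal (- \<beta>) \<le> RSAD1_objective z) \<longleftrightarrow> (- c, \<beta>) \<in> R1_cone T \<U>"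
  unfolding R1_cone_iff RSAD1_feasible_def RSAD1_objective_def
  by (auto simp: minus_equation_iff[of c] Bex_def; metis minus_minus)

lemma weak_duality:
  assumes "z \<in> RSAD1_feasible T \<U> c"
  shows "RSAD1_objective z \<le> inf_RSAP T \<U> c"
proof -
  obtain b where b: "RSAD1_objective z = ereal (- b)"
    by (cases z) (auto simp: RSAD1_objective_def)
  then have "(- c, b) \<in> R1_cone T \<U>"
    using assms RSAD1_feasible_ge_iff[of T \<U> c b] by force
  then have "(- c, b) \<in> system_consequences T \<U>"
    using R1_cone_subset_consequences by blast
  then show ?thesis
    unfolding b le_inf_RSAP_iff .
qed

text \<open>Attainment is what yields the inclusion: at a finite value, equality alone would only
  put (-c, \<beta> + \<epsilon>) into the cone for every \<epsilon> > 0. The point \<open>x0\<close>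
  keeps the primal value below \<infinity>.\<close>

lemma stable_robust_strong_duality1_iff:
  assumes "x0 \<in> RSAP_feasible T \<U>"
  shows "stable_robust_strong_duality1 T \<U> \<longleftrightarrow> system_consequences T \<U> \<subseteq> R1_cone T \<U>"
proof
  assume dual: "stable_robust_strong_duality1 T \<U>"
  show "system_consequences T \<U> \<subseteq> R1_cone T \<U>"
  proof
    fix k assume k: "k \<in> system_consequences T \<U>"
    let ?c = "- fst k"
    have ge: "ereal (- snd k) \<le> inf_RSAP T \<U> ?c"
      using k by (simp add: le_inf_RSAP_iff)
    have "inf_RSAP T \<U> ?c \<le> ereal (dual_apply ?c x0)"
      unfolding inf_RSAP_def using assms by (rule INF_lower)
    with ge have "\<bar>inf_RSAP T \<U> ?c\<bar> \<noteq> \<infinity>"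
      by (cases "inf_RSAP T \<U> ?c") auto
    then obtain z where "z \<in> RSAD1_feasible T \<U> ?c" "RSAD1_objective z = inf_RSAP T \<U> ?c"
      using dual unfolding stable_robust_strong_duality1_def by metis
    then have "(- ?c, snd k) \<in> R1_cone T \<U>"
      using ge unfolding RSAD1_feasible_ge_iff[symmetric] by metis
    then show "k \<in> R1_cone T \<U>" by simp
  qed
next
  assume sub: "system_consequences T \<U> \<subseteq> R1_cone T \<U>"
  have "inf_RSAP T \<U> c = sup_RSAD1 T \<U> c \<and> (\<bar>sup_RSAD1 T \<U> c\<bar> \<noteq> \<infinity> \<longrightarrow>
      (\<exists>z\<in>RSAD1_feasible T \<U> c. RSAD1_objective z = sup_RSAD1 T \<U> c))" for c
  proof -
    have le: "sup_RSAD1 T \<U> c \<le> inf_RSAP T \<U> c"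
      unfolding sup_RSAD1_def by (rule SUP_least) (rule weak_duality)
    have "inf_RSAP T \<U> c \<le> ereal (dual_apply c x0)"
      unfolding inf_RSAP_def using assms by (rule INF_lower)
    \<comment> \<open>At -\<infinity> weak duality gives equality, with nothing to attain. Otherwise
      (-c, b) lies in \<open>E\<close> for the optimal value -b, and the dual point read off from
      the cone is optimal.\<close>
    then consider "inf_RSAP T \<U> c = - \<infinity>" | b where "inf_RSAP T \<U> c = ereal (- b)"
      by (cases "inf_RSAP T \<U> c") (auto, metis minus_minus)
    then show ?thesis
    proof cases
      case 1
      then show ?thesis using le by simp
    next
      case 2
      then have "(- c, b) \<in> R1_cone T \<U>"
        using sub le_inf_RSAP_iff[of b T \<U> c] by auto
      then obtain z where z: "z \<in> RSAD1_feasible T \<U> c" "inf_RSAP T \<U> c \<le> RSAD1_objective z"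
        unfolding RSAD1_feasible_ge_iff[symmetric] 2 by blast
      moreover have "RSAD1_objective z \<le> sup_RSAD1 T \<U> c"
        unfolding sup_RSAD1_def using z(1) by (rule SUP_upper)
      ultimately show ?thesis using le by (metis order_antisym order_trans)
    qed
  qed
  then show "stable_robust_strong_duality1 T \<U>"
    unfolding stable_robust_strong_duality1_def by blast
qed

theorem corollary6p1:
  fixes T :: "'t set"
    and \<U> :: "'t \<Rightarrow> ('a::locally_convex_space dual set \<times> real) set"
  assumes "T \<noteq> {}"
    and "\<And>t. t \<in> T \<Longrightarrow> \<U> t \<noteq> {}"
    and "\<And>t. t \<in> T \<Longrightarrow> \<U> t \<subseteq> P0 \<times> UNIV"
    and "\<exists>x. \<forall>(\<A>, b)\<in>all_pairs T \<U>. support_fun \<A> x \<le> ereal b"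
  shows "closed (R1_cone T \<U>) \<and> convex (R1_cone T \<U>) \<longleftrightarrow> stable_robust_strong_duality1 T \<U>"
proof -
  obtain x0 where x0: "x0 \<in> RSAP_feasible T \<U>"
    using assms(4) by (auto simp: RSAP_feasible_def all_pairs_def)
  obtain t V where t: "t \<in> T" "V \<in> \<U> t"
    using assms(1,2) by blast
  then have V: "V \<in> all_pairs T \<U>"
    by (auto simp: all_pairs_def)
  have "fst V \<noteq> {}"
    using assms(3) t by (fastforce simp: P0_def)
  then obtain v where v: "v \<in> pair_set V"
    by (auto simp: pair_set_def)
  \<comment> \<open>Under the inclusion the cone equals \<open>E\<close> and inherits closedness and
    convexity; the converse is the separation argument.\<close>
  have "closed (R1_cone T \<U>) \<and> convex (R1_cone T \<U>) \<longleftrightarrow>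
      system_consequences T \<U> \<subseteq> R1_cone T \<U>"
    using consequences_subset_R1_cone[OF _ _ x0 V v] R1_cone_subset_consequences
      closed_system_consequences convex_system_consequences by (metis subset_antisym)
  then show ?thesis
    by (simp add: stable_robust_strong_duality1_iff[OF x0])
qed

end
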